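(* Let $f\in\mathcal C^1(E)$ be anisotropically smooth relative to $\phi$ with constant $L>0$, let $g:E\to\overline{\mathbb R}$ be proper, lsc and prox-bounded with threshold $\gamma_g>\gamma/\mu$, where $0<\gamma\le\frac1L$, and let $F=f+g$ with $F_\star=\inf F>-\infty$. Let $\{x^k\}_{k\in\mathbb N_0}$ be generated, from $x^0\in\operatorname{dom}g$, by $$y^k=x^k-\gamma\nabla\phi^*(\nabla f(x^k)),\qquad x^{k+1}\in\operatorname*{arg\,min}_{x\in E}\; g(x)+(\gamma\star\phi)(x-y^k).$$ Then for all $k\in\mathbb N$ $$F(x^{k+1})\le F(x^k)-\gamma\,\mathcal G^\phi_\gamma(x^k).$$ Moreover, every limit point of $\{x^k\}_{k\in\mathbb N}$ is a stationary point of $F$, and $$\min_{k\in\{0,1,\dots,K-1\}}\mathcal G^\phi_\gamma(x^k)\le\frac1{\gamma K}(F(x^0)-F_\star).$$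
   Context: $E$ is a Euclidean space with inner product $\langle\cdot,\cdot\rangle$ and induced norm $\|\cdot\|$; $\overline{\mathbb R}=\mathbb R\cup\{\pm\infty\}$. Standing assumptions on the reference function $\phi:E\to\overline{\mathbb R}$: $\phi$ is lsc, $\mu$-strongly convex ($\mu>0$) and even, $\phi\ge0$, $\phi(0)=0$; $\operatorname{int}\operatorname{dom}\phi\ne\emptyset$; $\phi\in\mathcal C^1(\operatorname{int}\operatorname{dom}\phi)$; and $\|\nabla\phi(x^k)\|\to+\infty$ for any sequence $\{x^k\}$ in $\operatorname{int}\operatorname{dom}\phi$ converging to a boundary point of $\operatorname{dom}\phi$. $\phi^*(y)=\sup_{x\in E}\langle y,x\rangle-\phi(x)$ is the convex conjugate (finite and differentiable on $E$). For $\lambda>0$, $(\lambda\star\phi)(x)=\lambda\phi(\lambda^{-1}x)$. Anisotropic smoothness: $f\in\mathcal C^1(E)$ is anisotropically smooth relative to $\phi$ with constant $L>0$ if for all $x,\bar x\in E$, $f(x)\le f(\bar x)+(\frac1L\star\phi)(x-\bar y)-(\frac1L\star\phi)(\bar x-\bar y)$, where $\bar y=\bar x-L^{-1}\nabla\phi^*(\nabla f(\bar x))$. $g$ is prox-bounded if there is $\lambda>0$ with $\inf_{x\in E}g(x)+\frac1{2\lambda}\|x-\bar x\|^2>-\infty$ for some $\bar x\in E$; the supremum of all such $\lambda$ is the threshold $\gamma_g$. Anisotropic Moreau envelope: $g^\phi_\gamma(y)=\inf_{x\in E}g(x)+(\gamma\star\phi)(x-y)$. Regularized gap function: $$\mathcal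 G^\phi_\gamma(x)=\tfrac1\gamma\left[g(x)+\gamma\phi(\nabla\phi^*(\nabla f(x)))-g^\phi_\gamma(x-\gamma\nabla\phi^*(\nabla f(x)))\right].$$ A stationary point of $F$ is a point $x^\star$ with $0\in\partial F(x^\star)$, $\partial$ being the limiting (Mordukhovich) subdifferential. *)

theory Defs
  imports "HOL-Analysis.Analysis"
begin

definition edom :: "('a \<Rightarrow> ereal) \<Rightarrow> 'a set" where
  "edom h = {x. h x < \<infinity>}"

definition proper :: "('a \<Rightarrow> ereal) \<Rightarrow> bool" where
  "proper h \<longleftrightarrow> (\<forall>x. h x \<noteq> - \<infinity>) \<and> edom h \<noteq> {}"

definition lsc :: "('a::topological_space \<Rightarrow> ereal) \<Rightarrow> bool" where
  "lsc h \<longleftrightarrow> (\<forall>x. h x \<le> Liminf (at x) h)"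

(* Only applied to functions that never take the value -\<infinity>, so no sum below is of the
   form \<infinity> + (-\<infinity>). *)
definition convex_ereal :: "('a::real_vector \<Rightarrow> ereal) \<Rightarrow> bool" where
  "convex_ereal h \<longleftrightarrow>
     (\<forall>x y. \<forall>t\<in>{0<..<1::real}.
        h ((1 - t) *\<^sub>R x + t *\<^sub>R y) \<le> ereal (1 - t) * h x + ereal t * h y)"

definition strongly_convex :: "real \<Rightarrow> ('a::real_inner \<Rightarrow> ereal) \<Rightarrow> bool" where
  "strongly_convex \<mu> h \<longleftrightarrow> \<mu> > 0 \<and> convex_ereal (\<lambda>x. h x - ereal (\<mu> / 2 * (norm x)\<^sup>2))"

definition grad :: "('a::real_inner \<Rightarrow> real) \<Rightarrow> 'a \<Rightarrow> 'a" where
  "grad h x = (THE D. GDERIV h x :> D)"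

(* Gradient of an extended-valued function; only used at points around which it is finite. *)
abbreviation egrad :: "('a::real_inner \<Rightarrow> ereal) \<Rightarrow> 'a \<Rightarrow> 'a" where
  "egrad h \<equiv> grad (\<lambda>x. real_of_ereal (h x))"

(* Meant for open S. *)
definition C1_on :: "'a::real_inner set \<Rightarrow> ('a \<Rightarrow> real) \<Rightarrow> bool" where
  "C1_on S h \<longleftrightarrow> (\<forall>x\<in>S. \<exists>D. GDERIV h x :> D) \<and> continuous_on S (grad h)"

definition reference_function :: "real \<Rightarrow> ('a::euclidean_space \<Rightarrow> ereal) \<Rightarrow> bool" where
  "reference_function \<mu> \<phi> \<longleftrightarrow>
     lsc \<phi> \<and> strongly_convex \<mu> \<phi> \<and> (\<forall>x. \<phi> (- x) = \<phi> x) \<and> (\<forall>x. \<phi> x \<ge> 0) \<and> \<phi> 0 = 0 \<and>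
     interior (edom \<phi>) \<noteq> {} \<and>
     C1_on (interior (edom \<phi>)) (\<lambda>x. real_of_ereal (\<phi> x)) \<and>
     (\<forall>x z. (\<forall>k::nat. x k \<in> interior (edom \<phi>)) \<and> z \<in> frontier (edom \<phi>) \<and> x \<longlonglongrightarrow> z
        \<longrightarrow> filterlim (\<lambda>k. norm (egrad \<phi> (x k))) at_top sequentially)"

definition conjugate :: "('a::real_inner \<Rightarrow> ereal) \<Rightarrow> 'a \<Rightarrow> ereal" where
  "conjugate h y = (SUP x. ereal (y \<bullet> x) - h x)"

definition epi_scale :: "real \<Rightarrow> ('a::real_vector \<Rightarrow> ereal) \<Rightarrow> 'a \<Rightarrow> ereal" where
  "epi_scale c h x = ereal c * h (x /\<^sub>R c)"

definition precond_grad :: "('a::real_inner \<Rightarrow> ereal) \<Rightarrow> ('a \<Rightarrow> real) \<Rightarrow> 'a \<Rightarrow> 'a" where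
  "precond_grad \<phi> f x = egrad (conjugate \<phi>) (grad f x)"

(* The subtracted term is c * \<phi> at a gradient of the conjugate of \<phi>, hence finite. *)
definition aniso_smooth :: "('a::real_inner \<Rightarrow> ereal) \<Rightarrow> real \<Rightarrow> ('a \<Rightarrow> real) \<Rightarrow> bool" where
  "aniso_smooth \<phi> L f \<longleftrightarrow> L > 0 \<and> C1_on UNIV f \<and>
     (\<forall>x xb. let yb = xb - (1 / L) *\<^sub>R precond_grad \<phi> f xb in
        ereal (f x) \<le> ereal (f xb) + epi_scale (1 / L) \<phi> (x - yb) - epi_scale (1 / L) \<phi> (xb - yb))"

definition prox_ok :: "('a::real_inner \<Rightarrow> ereal) \<Rightarrow> real \<Rightarrow> bool" where
  "prox_ok g l \<longleftrightarrow> l > 0 \<and> (\<exists>xb. (INF x. g x + ereal (1 / (2 * l) * (norm (x - xb))\<^sup>2)) > - \<infinity>)"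

definition prox_bounded :: "('a::real_inner \<Rightarrow> ereal) \<Rightarrow> bool" where
  "prox_bounded g \<longleftrightarrow> (\<exists>l. prox_ok g l)"

definition prox_threshold :: "('a::real_inner \<Rightarrow> ereal) \<Rightarrow> ereal" where
  "prox_threshold g = Sup (ereal ` {l. prox_ok g l})"

definition aniso_envelope ::
  "('a::real_vector \<Rightarrow> ereal) \<Rightarrow> real \<Rightarrow> ('a \<Rightarrow> ereal) \<Rightarrow> 'a \<Rightarrow> ereal" where
  "aniso_envelope \<phi> \<gamma> g y = (INF x. g x + epi_scale \<gamma> \<phi> (x - y))"

definition gap ::
  "('a::real_inner \<Rightarrow> ereal) \<Rightarrow> real \<Rightarrow> ('a \<Rightarrow> real) \<Rightarrow> ('a \<Rightarrow> ereal) \<Rightarrow> 'a \<Rightarrow> ereal" where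
  "gap \<phi> \<gamma> f g x =
     ereal (1 / \<gamma>) * (g x + ereal \<gamma> * \<phi> (precond_grad \<phi> f x)
       - aniso_envelope \<phi> \<gamma> g (x - \<gamma> *\<^sub>R precond_grad \<phi> f x))"

definition regular_subdiff :: "('a::real_inner \<Rightarrow> ereal) \<Rightarrow> 'a \<Rightarrow> 'a set" where
  "regular_subdiff h xb =
     {v. \<bar>h xb\<bar> \<noteq> \<infinity> \<and>
         Liminf (at xb) (\<lambda>x. (h x - h xb - ereal (v \<bullet> (x - xb))) / ereal (norm (x - xb))) \<ge> 0}"

definition limiting_subdiff :: "('a::real_inner \<Rightarrow> ereal) \<Rightarrow> 'a \<Rightarrow> 'a set" where
  "limiting_subdiff h xb =
     {v. \<bar>h xb\<bar> \<noteq> \<infinity> \<and>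
         (\<exists>x w. x \<longlonglongrightarrow> xb \<and> (\<lambda>k::nat. h (x k)) \<longlonglongrightarrow> h xb \<and>
                (\<forall>k. w k \<in> regular_subdiff h (x k)) \<and> w \<longlonglongrightarrow> v)}"

definition stationary_point :: "('a::real_inner \<Rightarrow> ereal) \<Rightarrow> 'a \<Rightarrow> bool" where
  "stationary_point h x \<longleftrightarrow> 0 \<in> limiting_subdiff h x"

definition seq_limit_point :: "(nat \<Rightarrow> 'a::topological_space) \<Rightarrow> 'a \<Rightarrow> bool" where
  "seq_limit_point x z \<longleftrightarrow> (\<exists>r. strict_mono r \<and> (x \<circ> r) \<longlonglongrightarrow> z)"

end

theory Submission
  imports Defs
begin

text \<open>
  Strong convexity makes \<open>p(v) = \<nabla>\<phi>\<^sup>*(v)\<close> the unique minimizer of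
  \<open>\<phi> - \<langle>v, \<cdot>\<rangle>\<close>, which depends on \<open>v\<close> in a Lipschitz way. Because
  \<open>\<nabla>\<phi>\<close> blows up at the boundary of the domain, \<open>p(v)\<close> lies in its interior
  (\<open>minimizer_interior\<close>), so \<open>\<nabla>\<phi>(p(v)) = v\<close> (\<open>GDERIV_at_egrad_conjugate\<close>) and
  \<open>\<phi>\<close> is smooth near \<open>p(v)\<close>.

  Descent: the secant slopes of the convex function \<open>\<phi>\<close> at \<open>p(\<nabla>f(x))\<close> are monotone, so
  the upper model of \<open>f\<close> that holds with parameter \<open>1/L\<close> also holds with every smaller
  \<open>\<gamma>\<close> (\<open>aniso_descent\<close>). Adding \<open>g\<close> and evaluating the model at its minimizer
  \<open>x\<^sup>k\<^sup>+\<^sup>1\<close> produces the envelope of \<open>g\<close>, that is,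
  \<open>F(x\<^sup>k\<^sup>+\<^sup>1) \<le> F(x\<^sup>k) - D\<^sub>k\<close> with \<open>D\<^sub>k = \<gamma> G(x\<^sup>k) \<ge> 0\<close> (\<open>forward_backward_step\<close>).
  Summing gives \<open>\<Sum>D\<^sub>k \<le> F(x\<^sup>0) - F\<^sub>\<star>\<close>, which bounds the smallest gap and forces
  \<open>D\<^sub>k \<longlonglongrightarrow> 0\<close>.

  Stationarity: the envelope need not be upper semicontinuous, since \<open>\<phi>\<close> may jump to
  \<open>\<infinity>\<close> at the boundary of its domain, so a limit point \<open>z\<close> need not have gap zero. A local
  version of this suffices (\<open>limit_point_stationary\<close>). Near \<open>z\<close> the arguments of \<open>\<phi>\<close> stay
  close to the interior point \<open>p(\<nabla>f(z))\<close>, where \<open>\<phi>\<close> is continuous, so the approximate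
  minimality of \<open>x\<^sup>k\<close> passes to the limit: \<open>z\<close> is a local minimizer of the model at \<open>z\<close>. The
  smooth part of the model has the gradient \<open>\<nabla>\<phi>(p(\<nabla>f(z))) = \<nabla>f(z)\<close> at \<open>z\<close>, and exchanging
  it for \<open>f\<close> leaves \<open>0\<close> a regular subgradient of \<open>F\<close>.
\<close>

section \<open>Lower semicontinuous functions\<close>

lemma lsc_open_superlevel:
  assumes "lsc h"
  shows "open {x. c < h x}"
proof (subst open_subopen, intro ballI)
  fix x assume "x \<in> {x. c < h x}"
  then have x: "c < h x" by simp
  then have "\<forall>\<^sub>F y in at x. c < h y"
    using assms unfolding lsc_def le_Liminf_iff by blast
  then have "\<forall>\<^sub>F y in nhds x. c < h y"
    using x by (simp add: eventually_nhds_conv_at)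
  then show "\<exists>T. open T \<and> x \<in> T \<and> T \<subseteq> {x. c < h x}"
    unfolding eventually_nhds by blast
qed

lemma lsc_if_eventually_above:
  assumes "\<And>x c. c < h x \<Longrightarrow> \<forall>\<^sub>F y in at x. c < h y"
  shows "lsc h"
  unfolding lsc_def le_Liminf_iff using assms by blast

lemma lsc_minus_continuous:
  fixes l :: "'a::topological_space \<Rightarrow> real"
  assumes h: "lsc h" and l: "continuous_on UNIV l"
  shows "lsc (\<lambda>x. h x - ereal (l x))"
proof (rule lsc_if_eventually_above)
  fix x c assume "c < h x - ereal (l x)"
  then obtain c0 where c0: "c < ereal c0" "ereal c0 < h x - ereal (l x)"
    using ereal_dense2 by blast
  then have "ereal (c0 + l x) < h x" by (cases "h x") auto
  then obtain c1 where c1: "ereal (c0 + l x) < ereal c1" "ereal c1 < h x"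
    using ereal_dense2 by blast
  have "\<forall>\<^sub>F y in nhds x. y \<in> {y. ereal c1 < h y}"
    by (rule eventually_nhds_in_open[OF lsc_open_superlevel[OF h]]) (use c1 in simp)
  moreover have "\<forall>\<^sub>F y in nhds x. y \<in> {y. l y < c1 - c0}"
    by (rule eventually_nhds_in_open[OF open_Collect_less[OF l continuous_on_const]])
      (use c1 in simp)
  ultimately have "\<forall>\<^sub>F y in nhds x. c < h y - ereal (l y)"
  proof eventually_elim
    case (elim y)
    then have "ereal c0 < h y - ereal (l y)" by (cases "h y") auto
    with c0 show ?case by order
  qed
  then show "\<forall>\<^sub>F y in at x. c < h y - ereal (l y)"
    by (simp add: eventually_nhds_conv_at)
qed

lemma lsc_attains_min:
  assumes h: "lsc h" and K: "compact K" "K \<noteq> {}"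
  shows "\<exists>x\<in>K. \<forall>y\<in>K. h x \<le> h y"
proof (rule ccontr)
  assume "\<not> ?thesis"
  then have "K \<subseteq> (\<Union>y\<in>K. {x. h y < h x})" by (force simp: not_le)
  then obtain C where C: "C \<subseteq> K" "finite C" "K \<subseteq> (\<Union>y\<in>C. {x. h y < h x})"
    by (rule compactE_image[OF K(1) lsc_open_superlevel[OF h]])
  with K have "C \<noteq> {}" by auto
  then obtain y0 where "y0 \<in> C" "\<And>y. y \<in> C \<Longrightarrow> h y0 \<le> h y"
    using C(2) ex_min_if_finite[of "h ` C"] by (auto simp: not_less)
  moreover from this C obtain y where "y \<in> C" "h y < h y0" by blast
  ultimately show False by (simp add: not_le[symmetric])
qed

lemma lsc_le_limit:
  assumes h: "lsc h" and X: "X \<longlonglongrightarrow> z"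
    and le: "\<forall>\<^sub>F j in sequentially. h (X j) \<le> ereal (b j)" and b: "b \<longlonglongrightarrow> B"
  shows "h z \<le> ereal B"
proof (rule ccontr)
  assume "\<not> ?thesis"
  then have "ereal B < h z" by simp
  then obtain c where c: "ereal B < ereal c" "ereal c < h z"
    using ereal_dense2 by blast
  have "\<forall>\<^sub>F j in sequentially. ereal c < h (X j)"
    using topological_tendstoD[OF X lsc_open_superlevel[OF h, of "ereal c"]] c by simp
  moreover have "\<forall>\<^sub>F j in sequentially. b j < c"
    using order_tendstoD(2)[OF b] c by simp
  ultimately have "\<forall>\<^sub>F j in sequentially. False"
    using le
  proof eventually_elim
    case (elim j)
    then have "ereal c < ereal (b j)" by order
    with elim(2) show ?case by simp
  qed
  then show False by simp
qed

section \<open>Gradients and subgradients\<close>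

lemma grad_eqI: "GDERIV h x :> D \<Longrightarrow> grad h x = D"
  unfolding grad_def
proof (rule the_equality)
  fix D' assume "GDERIV h x :> D" "GDERIV h x :> D'"
  then have "(\<lambda>u. u \<bullet> D') = (\<lambda>u. u \<bullet> D)"
    unfolding gderiv_def by (rule has_derivative_unique[rotated])
  then have "\<forall>u. u \<bullet> D' = u \<bullet> D" by (simp add: fun_eq_iff)
  then show "D' = D" unfolding vector_eq_ldot .
qed

lemma C1_on_GDERIV: "C1_on S h \<Longrightarrow> x \<in> S \<Longrightarrow> GDERIV h x :> grad h x"
  unfolding C1_on_def using grad_eqI by blast

text \<open>
  Fermat's rule with a change of the smooth part: on \<open>f + g = (s + g) + (f - s)\<close> the first summand
  is locally minimal at \<open>z\<close>, and the second is \<open>o(norm (x - z))\<close> up to a constant.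
\<close>
lemma regular_subgradient_zero_by_local_min:
  fixes f s :: "'a::real_inner \<Rightarrow> real"
  assumes f: "GDERIV f z :> v" and s: "GDERIV s z :> v" and gz: "g z = ereal gz"
    and min: "\<forall>\<^sub>F x in at z. g z + ereal (s z) \<le> g x + ereal (s x)"
  shows "0 \<in> regular_subdiff (\<lambda>x. ereal (f x) + g x) z"
proof -
  let ?F = "\<lambda>x. ereal (f x) + g x"
  let ?Q = "\<lambda>x. (?F x - ?F z - ereal (0 \<bullet> (x - z))) / ereal (norm (x - z))"
  have D: "((\<lambda>x. f x - s x) has_derivative (\<lambda>h. 0)) (at z)"
    using GDERIV_diff[OF f s] unfolding gderiv_def by simp
  have "0 \<le> Liminf (at z) ?Q"
    unfolding le_Liminf_iff
  proof (intro allI impI)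
    fix c :: ereal assume "c < 0"
    then obtain e where e: "c < ereal e" "ereal e < 0" using ereal_dense2 by blast
    have "\<forall>\<^sub>F x in at z. norm ((f x - s x) - (f z - s z)) / norm (x - z) < - e"
      using D e unfolding has_derivative_iff_norm by (auto dest!: order_tendstoD(2)[where a="-e"])
    moreover have "\<forall>\<^sub>F x in at z. x \<noteq> z" by (simp add: eventually_at_filter)
    ultimately show "\<forall>\<^sub>F x in at z. c < ?Q x" using min
    proof eventually_elim
      case (elim x)
      then have n: "norm (x - z) > 0" by simp
      have d: "(f x - s x) - (f z - s z) > e * norm (x - z)"
        using elim(1) n by (auto simp: field_simps)
      show ?case
      proof (cases "g x")
        case (real u)
        have "gz + s z \<le> u + s x" using elim(3) real gz by simp
        then have "e * norm (x - z) < f x + u - (f z + gz)" using d by simp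
        then have "e < (f x + u - (f z + gz)) / norm (x - z)" using n by (simp add: field_simps)
        then have "ereal e < ?Q x" using real gz n by simp
        with e show ?thesis by order
      qed (use elim n gz e in auto)
    qed
  qed
  then show ?thesis using gz unfolding regular_subdiff_def by simp
qed

lemma regular_subdiff_subset_limiting: "regular_subdiff h z \<subseteq> limiting_subdiff h z"
proof
  fix v assume v: "v \<in> regular_subdiff h z"
  then have "\<bar>h z\<bar> \<noteq> \<infinity>" by (simp add: regular_subdiff_def)
  moreover have "\<exists>x w. x \<longlonglongrightarrow> z \<and> (\<lambda>k::nat. h (x k)) \<longlonglongrightarrow> h z \<and>
                (\<forall>k. w k \<in> regular_subdiff h (x k)) \<and> w \<longlonglongrightarrow> v"
    by (rule exI[of _ "\<lambda>_. z"], rule exI[of _ "\<lambda>_. v"]) (use v in simp)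
  ultimately show "v \<in> limiting_subdiff h z" unfolding limiting_subdiff_def by blast
qed

section \<open>Reference functions and their conjugates\<close>

context
  fixes \<mu> :: real and \<phi> :: "'a::euclidean_space \<Rightarrow> ereal"
  assumes ref: "reference_function \<mu> \<phi>"
begin

abbreviation (input) "\<phi>r \<equiv> \<lambda>x. real_of_ereal (\<phi> x)"

lemma ref_mu_pos: "\<mu> > 0"
  using ref unfolding reference_function_def strongly_convex_def by blast

lemma ref_nonneg: "0 \<le> \<phi> x"
  using ref unfolding reference_function_def by blast

lemma ref_zero: "\<phi> 0 = 0"
  using ref unfolding reference_function_def by blast

lemma ref_even: "\<phi> (- x) = \<phi> x"
  using ref unfolding reference_function_def by blast

lemma ref_finite: "x \<in> edom \<phi> \<Longrightarrow> \<phi> x = ereal (\<phi>r x)"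
  using ref_nonneg[of x] unfolding edom_def by (cases "\<phi> x") auto

lemma ref_infinite: "x \<notin> edom \<phi> \<Longrightarrow> \<phi> x = \<infinity>"
  unfolding edom_def by auto

lemma ref_strong_convexity:
  assumes x: "x \<in> edom \<phi>" and y: "y \<in> edom \<phi>" and t: "0 < t" "t < 1"
  defines "m \<equiv> (1 - t) *\<^sub>R x + t *\<^sub>R y"
  shows "m \<in> edom \<phi>"
    and "\<phi>r m \<le> (1 - t) * \<phi>r x + t * \<phi>r y - \<mu> / 2 * (t * (1 - t)) * (norm (x - y))\<^sup>2"
proof -
  have "\<phi> m - ereal (\<mu> / 2 * (norm m)\<^sup>2) \<le> ereal (1 - t) * (\<phi> x - ereal (\<mu> / 2 * (norm x)\<^sup>2))
      + ereal t * (\<phi> y - ereal (\<mu> / 2 * (norm y)\<^sup>2))"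
    using ref t unfolding reference_function_def strongly_convex_def convex_ereal_def m_def by simp
  also have "\<dots> = ereal ((1 - t) * (\<phi>r x - \<mu> / 2 * (norm x)\<^sup>2) + t * (\<phi>r y - \<mu> / 2 * (norm y)\<^sup>2))"
    by (subst ref_finite[OF x], subst ref_finite[OF y]) simp
  finally have le: "\<phi> m - ereal (\<mu> / 2 * (norm m)\<^sup>2) \<le>
    ereal ((1 - t) * (\<phi>r x - \<mu> / 2 * (norm x)\<^sup>2) + t * (\<phi>r y - \<mu> / 2 * (norm y)\<^sup>2))" .
  then show m: "m \<in> edom \<phi>" unfolding edom_def by (cases "\<phi> m") auto
  have id: "(norm m)\<^sup>2 = (1 - t) * (norm x)\<^sup>2 + t * (norm y)\<^sup>2 - t * (1 - t) * (norm (x - y))\<^sup>2"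
    unfolding m_def power2_norm_eq_inner
    by (simp add: inner_add_left inner_add_right inner_diff_left inner_diff_right inner_commute
        algebra_simps)
  have "\<phi>r m \<le> (1 - t) * (\<phi>r x - \<mu> / 2 * (norm x)\<^sup>2) + t * (\<phi>r y - \<mu> / 2 * (norm y)\<^sup>2)
      + \<mu> / 2 * (norm m)\<^sup>2"
    using le ref_finite[OF m] by (cases "\<phi> m") auto
  also have "\<dots> = (1 - t) * \<phi>r x + t * \<phi>r y - \<mu> / 2 * (t * (1 - t)) * (norm (x - y))\<^sup>2"
    unfolding id by (simp add: field_simps)
  finally show "\<phi>r m \<le> (1 - t) * \<phi>r x + t * \<phi>r y - \<mu> / 2 * (t * (1 - t)) * (norm (x - y))\<^sup>2" .
qed

lemma ref_convex:
  assumes "x \<in> edom \<phi>" "y \<in> edom \<phi>" "0 \<le> t" "t \<le> 1"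
  shows "\<phi>r ((1 - t) *\<^sub>R x + t *\<^sub>R y) \<le> (1 - t) * \<phi>r x + t * \<phi>r y"
proof (cases "t = 0 \<or> t = 1")
  case False
  then have t: "0 < t" "t < 1" using assms by auto
  have "0 \<le> \<mu> / 2 * (t * (1 - t)) * (norm (x - y))\<^sup>2"
    using ref_mu_pos t by (intro mult_nonneg_nonneg) auto
  then show ?thesis using ref_strong_convexity(2)[OF assms(1,2) t] by linarith
qed auto

lemma ref_dom_convex: "convex (edom \<phi>)"
  unfolding convex_alt
proof (intro ballI allI impI)
  fix x y and t :: real assume a: "x \<in> edom \<phi>" "y \<in> edom \<phi>" "0 \<le> t \<and> t \<le> 1"
  show "(1 - t) *\<^sub>R x + t *\<^sub>R y \<in> edom \<phi>"
  proof (cases "t = 0 \<or> t = 1")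
    case False
    then show ?thesis using ref_strong_convexity(1)[of x y t] a by auto
  qed (use a in auto)
qed

text \<open>
  By evenness the midpoint of \<open>x\<close> and \<open>- x\<close> is \<open>0\<close>, the zero of \<open>\<phi>\<close>. This is the
  coercivity that makes the conjugate finite.
\<close>
lemma ref_quadratic_lower_bound:
  assumes "x \<in> edom \<phi>"
  shows "\<mu> / 2 * (norm x)\<^sup>2 \<le> \<phi>r x"
proof -
  have "- x \<in> edom \<phi>" using assms by (simp add: edom_def ref_even)
  from ref_strong_convexity(2)[OF assms this, of "1/2"]
  have "0 \<le> \<phi>r x - \<mu> / 2 * (1/4) * (norm (x + x))\<^sup>2"
    by (simp add: ref_even ref_zero)
  moreover have "(norm (x + x))\<^sup>2 = 4 * (norm x)\<^sup>2"
    by (simp flip: scaleR_2 add: power_mult_distrib)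
  ultimately show ?thesis by simp
qed

lemma ref_tilt_attains_min:
  "\<exists>p\<in>edom \<phi>. \<forall>x\<in>edom \<phi>. \<phi>r p - y \<bullet> p \<le> \<phi>r x - y \<bullet> x"
proof -
  \<comment> \<open>Outside this radius the quadratic lower bound makes the tilted function nonnegative,
    and at \<open>0\<close> it vanishes.\<close>
  let ?R = "2 * norm y / \<mu>"
  have z: "0 \<in> edom \<phi>" by (simp add: edom_def ref_zero)
  have "lsc \<phi>" using ref unfolding reference_function_def by blast
  then have "lsc (\<lambda>x. \<phi> x - ereal (y \<bullet> x))"
    by (rule lsc_minus_continuous) (intro continuous_intros)
  moreover have zR: "0 \<in> cball (0::'a) ?R" using ref_mu_pos by simp
  ultimately have "\<exists>p\<in>cball 0 ?R. \<forall>x\<in>cball 0 ?R. \<phi> p - ereal (y \<bullet> p) \<le> \<phi> x - ereal (y \<bullet> x)"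
    by (intro lsc_attains_min compact_cball) auto
  then obtain p where
    p: "\<And>x. x \<in> cball 0 ?R \<Longrightarrow> \<phi> p - ereal (y \<bullet> p) \<le> \<phi> x - ereal (y \<bullet> x)"
    by blast
  have "\<phi> p - ereal (y \<bullet> p) \<le> 0" using p[OF zR] by (simp add: ref_zero)
  then have pd: "p \<in> edom \<phi>" unfolding edom_def by (cases "\<phi> p") auto
  have le: "\<phi>r p - y \<bullet> p \<le> \<phi>r x - y \<bullet> x" if x: "x \<in> edom \<phi>" "x \<in> cball 0 ?R" for x
    using p[OF x(2)] ref_finite[OF x(1)] ref_finite[OF pd]
    by (cases "\<phi> x"; cases "\<phi> p") auto
  have "\<phi>r p - y \<bullet> p \<le> \<phi>r x - y \<bullet> x" if x: "x \<in> edom \<phi>" for x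
  proof (cases "x \<in> cball 0 ?R")
    case False
    then have "norm y \<le> \<mu> / 2 * norm x" using ref_mu_pos by (simp add: field_simps)
    then have "norm y * norm x \<le> \<mu> / 2 * norm x * norm x"
      by (rule mult_right_mono) simp
    also have "\<dots> \<le> \<phi>r x" using ref_quadratic_lower_bound[OF x] by (simp add: power2_eq_square)
    finally have "y \<bullet> x \<le> \<phi>r x" using norm_cauchy_schwarz[of y x] by linarith
    then show ?thesis using le[OF z zR] by (simp add: ref_zero)
  qed (use le x in blast)
  with pd show ?thesis by blast
qed

text \<open>
  Compare \<open>p\<close> with \<open>(1 - t) p + t x\<close>: minimality and strong convexity give the bound with the factor
  \<open>1 - t\<close> in front of the quadratic term, and \<open>t\<close> tends to \<open>0\<close>.
\<close>
lemma ref_quadratic_growth: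
  assumes p: "p \<in> edom \<phi>" and min: "\<And>x. x \<in> edom \<phi> \<Longrightarrow> \<phi>r p - y \<bullet> p \<le> \<phi>r x - y \<bullet> x"
    and x: "x \<in> edom \<phi>"
  shows "\<phi>r p - y \<bullet> p + \<mu> / 2 * (norm (x - p))\<^sup>2 \<le> \<phi>r x - y \<bullet> x"
proof -
  let ?B = "\<mu> / 2 * (norm (x - p))\<^sup>2" and ?A = "(\<phi>r x - y \<bullet> x) - (\<phi>r p - y \<bullet> p)"
  have "(1 - t) * ?B \<le> ?A" if t: "0 < t" "t < 1" for t
  proof -
    let ?m = "(1 - t) *\<^sub>R p + t *\<^sub>R x"
    have "\<phi>r p - y \<bullet> p \<le> \<phi>r ?m - y \<bullet> ?m"
      using min ref_strong_convexity(1)[OF p x t] by blast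
    also have "\<dots> \<le> (1 - t) * \<phi>r p + t * \<phi>r x - \<mu> / 2 * (t * (1 - t)) * (norm (x - p))\<^sup>2 - y \<bullet> ?m"
      using ref_strong_convexity(2)[OF p x t] by (simp add: norm_minus_commute)
    finally have "t * ((1 - t) * ?B) \<le> t * ?A"
      by (simp add: inner_add_right algebra_simps)
    then show ?thesis using t by simp
  qed
  then have "\<forall>\<^sub>F t in at_right 0. (1 - t) * ?B \<le> ?A"
    using eventually_at_right_real[of 0 1] by (auto elim!: eventually_mono)
  moreover have "((\<lambda>t. (1 - t) * ?B) \<longlongrightarrow> (1 - 0) * ?B) (at_right 0)"
    by (intro tendsto_intros)
  ultimately have "(1 - 0) * ?B \<le> ?A"
    using tendsto_upperbound trivial_limit_at_right_real by blast
  then show ?thesis by simp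
qed

lemma conjugate_eq_at_minimizer:
  assumes p: "p \<in> edom \<phi>" and min: "\<And>x. x \<in> edom \<phi> \<Longrightarrow> \<phi>r p - y \<bullet> p \<le> \<phi>r x - y \<bullet> x"
  shows "conjugate \<phi> y = ereal (y \<bullet> p - \<phi>r p)"
  unfolding conjugate_def
proof (rule antisym)
  show "(SUP x. ereal (y \<bullet> x) - \<phi> x) \<le> ereal (y \<bullet> p - \<phi>r p)"
  proof (rule SUP_least)
    fix x
    show "ereal (y \<bullet> x) - \<phi> x \<le> ereal (y \<bullet> p - \<phi>r p)"
    proof (cases "x \<in> edom \<phi>")
      case True
      then show ?thesis using min[OF True] by (subst ref_finite) auto
    qed (simp add: ref_infinite)
  qed
  have "ereal (y \<bullet> p - \<phi>r p) = ereal (y \<bullet> p) - \<phi> p" by (subst (2) ref_finite[OF p]) simp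
  also have "\<dots> \<le> (SUP x. ereal (y \<bullet> x) - \<phi> x)" by (rule SUP_upper) simp
  finally show "ereal (y \<bullet> p - \<phi>r p) \<le> (SUP x. ereal (y \<bullet> x) - \<phi> x)" .
qed

text \<open>
  Adding the growth bounds of the two tilted problems cancels \<open>\<phi>\<close> and leaves strong monotonicity
  of the inverse map.
\<close>
lemma minimizer_lipschitz:
  assumes p: "p \<in> edom \<phi>" "\<And>x. x \<in> edom \<phi> \<Longrightarrow> \<phi>r p - y \<bullet> p \<le> \<phi>r x - y \<bullet> x"
    and p': "p' \<in> edom \<phi>" "\<And>x. x \<in> edom \<phi> \<Longrightarrow> \<phi>r p' - y' \<bullet> p' \<le> \<phi>r x - y' \<bullet> x"
  shows "norm (p' - p) \<le> norm (y' - y) / \<mu>"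
proof -
  have "\<mu> * (norm (p' - p))\<^sup>2 \<le> (y' - y) \<bullet> (p' - p)"
    using ref_quadratic_growth[OF p p'(1)] ref_quadratic_growth[OF p' p(1)]
    by (simp add: norm_minus_commute inner_diff_left inner_diff_right)
  also have "\<dots> \<le> norm (y' - y) * norm (p' - p)" by (rule norm_cauchy_schwarz)
  finally have "norm (p' - p) * (\<mu> * norm (p' - p)) \<le> norm (p' - p) * norm (y' - y)"
    by (simp add: power2_eq_square algebra_simps)
  then have "\<mu> * norm (p' - p) \<le> norm (y' - y)"
    by (cases "norm (p' - p) = 0") (auto simp: mult_le_cancel_left)
  then show ?thesis using ref_mu_pos by (simp add: field_simps)
qed

text \<open>
  The minimizer for either of two points \<open>y\<close>, \<open>y'\<close> is a competitor for the other, which encloses the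
  linearization error of the conjugate between \<open>0\<close> and \<open>(y' - y) \<bullet> (p' - p)\<close>. By the Lipschitz bound
  this is quadratically small.
\<close>
lemma egrad_conjugate_eq_minimizer:
  assumes p: "p \<in> edom \<phi>" "\<And>x. x \<in> edom \<phi> \<Longrightarrow> \<phi>r p - y \<bullet> p \<le> \<phi>r x - y \<bullet> x"
  shows "egrad (conjugate \<phi>) y = p"
proof (rule grad_eqI)
  let ?c = "\<lambda>y. real_of_ereal (conjugate \<phi> y)"
  have c: "?c y = y \<bullet> p - \<phi>r p" using conjugate_eq_at_minimizer[OF p] by simp
  have bound: "norm (?c y' - ?c y - (y' - y) \<bullet> p) / norm (y' - y) \<le> norm (y' - y) / \<mu>" for y'
  proof -
    obtain p' where p': "p' \<in> edom \<phi>" "\<And>x. x \<in> edom \<phi> \<Longrightarrow> \<phi>r p' - y' \<bullet> p' \<le> \<phi>r x - y' \<bullet> x"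
      using ref_tilt_attains_min by blast
    have c': "?c y' = y' \<bullet> p' - \<phi>r p'" using conjugate_eq_at_minimizer[OF p'] by simp
    have "0 \<le> ?c y' - ?c y - (y' - y) \<bullet> p"
      unfolding c c' using p'(2)[OF p(1)] by (simp add: inner_diff_left)
    moreover have "?c y' - ?c y - (y' - y) \<bullet> p \<le> (y' - y) \<bullet> (p' - p)"
      unfolding c c' using p(2)[OF p'(1)] by (simp add: inner_diff_left inner_diff_right)
    moreover have "(y' - y) \<bullet> (p' - p) \<le> norm (y' - y) * norm (p' - p)"
      by (rule norm_cauchy_schwarz)
    moreover have "\<dots> \<le> norm (y' - y) * (norm (y' - y) / \<mu>)"
      by (intro mult_left_mono minimizer_lipschitz[OF p p']) auto
    ultimately have "norm (?c y' - ?c y - (y' - y) \<bullet> p) \<le> norm (y' - y) * (norm (y' - y) / \<mu>)"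
      by simp
    then show ?thesis using ref_mu_pos by (cases "y' = y") (auto simp: field_simps)
  qed
  have "((\<lambda>y'. norm (y' - y) / \<mu>) \<longlongrightarrow> norm (y - y) / \<mu>) (at y)"
    by (intro tendsto_intros) (use ref_mu_pos in simp)
  then have lim: "((\<lambda>y'. norm (y' - y) / \<mu>) \<longlongrightarrow> 0) (at y)" by simp
  have "((\<lambda>y'. norm (?c y' - ?c y - (y' - y) \<bullet> p) / norm (y' - y)) \<longlongrightarrow> 0) (at y)"
    by (rule tendsto_sandwich[OF _ _ tendsto_const lim])
      (rule always_eventually, rule allI, simp, rule always_eventually, rule allI, rule bound)
  then show "GDERIV ?c y :> p"
    unfolding gderiv_def has_derivative_iff_norm by (simp add: bounded_linear_inner_left)
qed

lemma egrad_conjugate_minimizes: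
  shows "egrad (conjugate \<phi>) y \<in> edom \<phi>"
    and "x \<in> edom \<phi> \<Longrightarrow>
      \<phi>r (egrad (conjugate \<phi>) y) - y \<bullet> egrad (conjugate \<phi>) y \<le> \<phi>r x - y \<bullet> x"
proof -
  obtain p where p: "p \<in> edom \<phi>" "\<And>x. x \<in> edom \<phi> \<Longrightarrow> \<phi>r p - y \<bullet> p \<le> \<phi>r x - y \<bullet> x"
    using ref_tilt_attains_min by blast
  have eq: "egrad (conjugate \<phi>) y = p" by (rule egrad_conjugate_eq_minimizer[OF p])
  show "egrad (conjugate \<phi>) y \<in> edom \<phi>" unfolding eq by (rule p(1))
  show "\<phi>r (egrad (conjugate \<phi>) y) - y \<bullet> egrad (conjugate \<phi>) y \<le> \<phi>r x - y \<bullet> x" if "x \<in> edom \<phi>"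
    unfolding eq by (rule p(2)[OF that])
qed

lemma continuous_egrad_conjugate: "continuous_on UNIV (egrad (conjugate \<phi>))"
proof -
  have "(1 / \<mu>)-lipschitz_on UNIV (egrad (conjugate \<phi>))"
    using minimizer_lipschitz[OF egrad_conjugate_minimizes egrad_conjugate_minimizes] ref_mu_pos
    by (intro lipschitz_onI) (auto simp: dist_norm)
  then show ?thesis by (rule lipschitz_on_continuous_on)
qed

lemma ref_GDERIV_interior:
  "x \<in> interior (edom \<phi>) \<Longrightarrow> GDERIV \<phi>r x :> egrad \<phi> x"
  using ref C1_on_GDERIV unfolding reference_function_def by blast

lemma ref_isCont_interior: "x \<in> interior (edom \<phi>) \<Longrightarrow> isCont \<phi>r x"
  using ref_GDERIV_interior unfolding gderiv_def by (blast dest: has_derivative_continuous)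

lemma ref_gradient_inequality:
  assumes x: "x \<in> interior (edom \<phi>)" and z: "z \<in> edom \<phi>"
  shows "\<phi>r x + egrad \<phi> x \<bullet> (z - x) \<le> \<phi>r z"
proof -
  have xd: "x \<in> edom \<phi>" using x interior_subset by blast
  let ?d = "\<lambda>t::real. \<phi>r (x + t *\<^sub>R (z - x))"
  have "(\<phi>r has_derivative (\<lambda>h. h \<bullet> egrad \<phi> x)) (at (x + 0 *\<^sub>R (z - x)))"
    using ref_GDERIV_interior[OF x] by (simp add: gderiv_def)
  then have "(?d has_derivative (\<lambda>t. (t *\<^sub>R (z - x)) \<bullet> egrad \<phi> x)) (at 0)"
    by (rule has_derivative_compose[where f="\<lambda>t. x + t *\<^sub>R (z - x)", rotated])
      (auto intro!: derivative_eq_intros)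
  then have "(?d has_real_derivative (z - x) \<bullet> egrad \<phi> x) (at 0)"
    by (simp add: has_field_derivative_def mult_commute_abs)
  then have "((\<lambda>t. (?d (0 + t) - ?d 0) / t) \<longlongrightarrow> (z - x) \<bullet> egrad \<phi> x) (at_right 0)"
    unfolding DERIV_def by (rule filterlim_mono) (auto simp: at_within_le_at)
  moreover have "\<forall>\<^sub>F t in at_right 0. (?d (0 + t) - ?d 0) / t \<le> \<phi>r z - \<phi>r x"
    using eventually_at_right_real[of 0 1, simplified]
  proof eventually_elim
    case (elim t)
    then have t: "0 < t" "t < 1" by auto
    have "x + t *\<^sub>R (z - x) = (1 - t) *\<^sub>R x + t *\<^sub>R z" by (simp add: algebra_simps)
    then have "?d t \<le> (1 - t) * \<phi>r x + t * \<phi>r z" using ref_convex[OF xd z, of t] t by simp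
    then show ?case using t by (simp add: field_simps)
  qed
  ultimately have "(z - x) \<bullet> egrad \<phi> x \<le> \<phi>r z - \<phi>r x"
    using tendsto_upperbound trivial_limit_at_right_real by blast
  then show ?thesis by (simp add: inner_commute)
qed

text \<open>
  If \<open>p\<close> were a boundary point, the gradients along a segment from \<open>p\<close> to an interior point \<open>c\<close> would
  stay bounded, against the blow-up assumption: convexity bounds the slope of \<open>\<phi>\<close> towards every point
  of a ball around \<open>c\<close> from above, and minimality of \<open>p\<close> bounds the slope towards \<open>c\<close> from below.
\<close>
lemma minimizer_interior:
  assumes p: "p \<in> edom \<phi>" and min: "\<And>x. x \<in> edom \<phi> \<Longrightarrow> \<phi>r p - y \<bullet> p \<le> \<phi>r x - y \<bullet> x"
  shows "p \<in> interior (edom \<phi>)"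
proof (rule ccontr)
  assume np: "p \<notin> interior (edom \<phi>)"
  obtain c where c: "c \<in> interior (edom \<phi>)"
    using ref unfolding reference_function_def by blast
  define X where "X t = p + t *\<^sub>R (c - p)" for t
  have Xi: "X t \<in> interior (edom \<phi>)" if "0 < t" "t \<le> 1" for t
    using mem_interior_closure_convex_shrink[OF ref_dom_convex c, of p t] that p closure_subset
    by (auto simp: X_def algebra_simps)
  have "\<forall>\<^sub>F x in nhds c. \<phi>r x < \<phi>r c + 1"
    using order_tendstoD(2)[OF isContD[OF ref_isCont_interior[OF c]], of "\<phi>r c + 1"]
    by (simp add: eventually_nhds_conv_at)
  moreover have "\<forall>\<^sub>F x in nhds c. x \<in> interior (edom \<phi>)"
    using c by (intro eventually_nhds_in_open) auto
  ultimately have "\<forall>\<^sub>F x in nhds c. \<phi>r x < \<phi>r c + 1 \<and> x \<in> interior (edom \<phi>)"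
    by (rule eventually_conj)
  then obtain e where e: "e > 0" and
    ball: "\<And>x. dist x c < e \<Longrightarrow> \<phi>r x < \<phi>r c + 1 \<and> x \<in> interior (edom \<phi>)"
    unfolding eventually_nhds_metric by blast
  define C where "C = \<phi>r c + 1 - \<phi>r p - y \<bullet> (c - p)"
  have bound: "norm (egrad \<phi> (X t)) \<le> 2 * C / e" if t: "0 < t" "t \<le> 1" for t
  proof -
    let ?v = "egrad \<phi> (X t)"
    \<comment> \<open>The direction of the gradient itself, scaled to stay in the ball, turns slopes into norms.\<close>
    define u where "u = (e / 2) *\<^sub>R sgn ?v"
    have "norm u < e" using e by (auto simp: u_def norm_sgn)
    then have cu: "\<phi>r (c + u) < \<phi>r c + 1" "c + u \<in> edom \<phi>"
      using ball[of "c + u"] interior_subset by (auto simp: dist_norm)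
    have eq: "X t + t *\<^sub>R u = (1 - t) *\<^sub>R p + t *\<^sub>R (c + u)" by (simp add: X_def algebra_simps)
    have dom: "X t + t *\<^sub>R u \<in> edom \<phi>"
      unfolding eq using ref_dom_convex p cu t by (auto simp: convex_alt)
    have "\<phi>r (X t) + ?v \<bullet> (t *\<^sub>R u) \<le> \<phi>r (X t + t *\<^sub>R u)"
      using ref_gradient_inequality[OF Xi[OF t] dom] by simp
    also have "\<dots> \<le> (1 - t) * \<phi>r p + t * \<phi>r (c + u)"
      unfolding eq using ref_convex[OF p cu(2)] t by simp
    also have "\<dots> \<le> (1 - t) * \<phi>r p + t * (\<phi>r c + 1)" using cu t by simp
    finally have "t * (?v \<bullet> u) \<le> t * (\<phi>r c + 1) + (1 - t) * \<phi>r p - \<phi>r (X t)" by simp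
    moreover have "\<phi>r p + t * (y \<bullet> (c - p)) \<le> \<phi>r (X t)"
      using min[OF subsetD[OF interior_subset Xi[OF t]]] by (simp add: X_def inner_add_right)
    ultimately have "t * (?v \<bullet> u) \<le> t * C" by (simp add: C_def algebra_simps)
    then have "?v \<bullet> u \<le> C" using t by simp
    moreover have "?v \<bullet> u = e / 2 * norm ?v"
      by (cases "?v = 0") (simp_all add: u_def sgn_div_norm dot_square_norm power2_eq_square)
    ultimately show ?thesis using e by (simp add: field_simps)
  qed
  define x where "x k = X (1 / real (Suc k))" for k
  have "\<And>k. x k \<in> interior (edom \<phi>)" unfolding x_def by (rule Xi) auto
  moreover have "p \<in> frontier (edom \<phi>)" using p np closure_subset unfolding frontier_def by blast
  moreover have "x \<longlonglongrightarrow> p + 0 *\<^sub>R (c - p)"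
    unfolding x_def X_def by (intro tendsto_intros LIMSEQ_Suc lim_1_over_n)
  then have "x \<longlonglongrightarrow> p" by simp
  ultimately have "filterlim (\<lambda>k. norm (egrad \<phi> (x k))) at_top sequentially"
    using ref unfolding reference_function_def by blast
  then have "\<forall>\<^sub>F k in sequentially. 2 * C / e < norm (egrad \<phi> (x k))"
    by (simp add: filterlim_at_top_dense)
  moreover have "norm (egrad \<phi> (x k)) \<le> 2 * C / e" for k
    unfolding x_def by (rule bound) auto
  ultimately show False by (simp add: not_less[symmetric])
qed

lemma egrad_conjugate_interior: "egrad (conjugate \<phi>) y \<in> interior (edom \<phi>)"
  by (rule minimizer_interior[OF egrad_conjugate_minimizes])

text \<open>
  Fermat's rule at the interior minimizer: \<open>\<nabla>\<phi>\<close> and \<open>\<nabla>\<phi>\<^sup>*\<close> are inverse to each other.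
\<close>
lemma GDERIV_at_egrad_conjugate: "GDERIV \<phi>r (egrad (conjugate \<phi>) y) :> y"
proof -
  let ?p = "egrad (conjugate \<phi>) y"
  have D: "GDERIV \<phi>r ?p :> egrad \<phi> ?p" by (rule ref_GDERIV_interior[OF egrad_conjugate_interior])
  have "((\<lambda>x. \<phi>r x - y \<bullet> x) has_derivative (\<lambda>h. h \<bullet> egrad \<phi> ?p - y \<bullet> h)) (at ?p)"
    using D unfolding gderiv_def by (auto intro!: derivative_eq_intros)
  moreover have "\<forall>\<^sub>F x in at ?p. \<phi>r ?p - y \<bullet> ?p \<le> \<phi>r x - y \<bullet> x"
  proof -
    have "\<forall>\<^sub>F x in at ?p. x \<in> interior (edom \<phi>)"
      by (rule eventually_at_in_open'[OF open_interior egrad_conjugate_interior])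
    then show ?thesis
      by (rule eventually_mono) (use egrad_conjugate_minimizes(2) interior_subset in blast)
  qed
  ultimately have "(\<lambda>h. h \<bullet> egrad \<phi> ?p - y \<bullet> h) = (\<lambda>h. 0)"
    by (rule has_derivative_local_min)
  then have "(egrad \<phi> ?p - y) \<bullet> egrad \<phi> ?p - y \<bullet> (egrad \<phi> ?p - y) = 0"
    by (rule fun_cong)
  then have "(egrad \<phi> ?p - y) \<bullet> (egrad \<phi> ?p - y) = 0"
    by (simp add: inner_diff_right inner_diff_left inner_commute)
  then have "egrad \<phi> ?p = y" by simp
  with D show ?thesis by simp
qed

section \<open>One forward-backward step\<close>

lemma epi_scale_ref_finite:
  "x /\<^sub>R c \<in> edom \<phi> \<Longrightarrow> epi_scale c \<phi> x = ereal (c * \<phi>r (x /\<^sub>R c))"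
  unfolding epi_scale_def using ref_finite[of "x /\<^sub>R c"] by (cases "\<phi> (x /\<^sub>R c)") auto

text \<open>
  In terms of \<open>t = 1 / c\<close> the right-hand side is the secant slope \<open>(\<phi>(p + t u) - \<phi>(p)) / t\<close>, which
  is nondecreasing in \<open>t\<close> by convexity.
\<close>
lemma secant_slope_mono:
  assumes p: "p \<in> edom \<phi>" and c: "0 < c" "c \<le> b"
    and q: "p + u /\<^sub>R c \<in> edom \<phi>"
  shows "p + u /\<^sub>R b \<in> edom \<phi>"
    and "b * \<phi>r (p + u /\<^sub>R b) - b * \<phi>r p \<le> c * \<phi>r (p + u /\<^sub>R c) - c * \<phi>r p"
proof -
  let ?t = "c / b"
  have t: "0 \<le> ?t" "?t \<le> 1" using c by auto
  have eq: "p + u /\<^sub>R b = (1 - ?t) *\<^sub>R p + ?t *\<^sub>R (p + u /\<^sub>R c)"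
    using c by (simp add: algebra_simps divide_inverse)
  show "p + u /\<^sub>R b \<in> edom \<phi>"
    unfolding eq using ref_dom_convex p q t by (auto simp: convex_alt)
  have "b * \<phi>r (p + u /\<^sub>R b) \<le> b * ((1 - ?t) * \<phi>r p + ?t * \<phi>r (p + u /\<^sub>R c))"
    unfolding eq using ref_convex[OF p q t] c by (intro mult_left_mono) auto
  also have "\<dots> = b * \<phi>r p - c * \<phi>r p + c * \<phi>r (p + u /\<^sub>R c)"
    using c by (simp add: field_simps)
  finally show "b * \<phi>r (p + u /\<^sub>R b) - b * \<phi>r p \<le> c * \<phi>r (p + u /\<^sub>R c) - c * \<phi>r p" by simp
qed

text \<open>
  The smoothness inequality with the parameter \<open>1 / L\<close> replaced by a smaller one. Where
  the new model is infinite there is nothing to show, hence the domain assumption.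
\<close>
lemma aniso_descent:
  fixes x xb :: 'a
  assumes f: "aniso_smooth \<phi> L f" and c: "0 < \<gamma>" "\<gamma> \<le> 1 / L"
  defines "p \<equiv> precond_grad \<phi> f xb"
  assumes dom: "p + (x - xb) /\<^sub>R \<gamma> \<in> edom \<phi>"
  shows "f x \<le> f xb + \<gamma> * \<phi>r (p + (x - xb) /\<^sub>R \<gamma>) - \<gamma> * \<phi>r p"
proof -
  have L: "L > 0" using f unfolding aniso_smooth_def by blast
  have p: "p \<in> edom \<phi>" unfolding p_def precond_grad_def by (rule egrad_conjugate_minimizes(1))
  note mono = secant_slope_mono[OF p c dom]
  let ?yb = "xb - (1 / L) *\<^sub>R p"
  have a: "(x - ?yb) /\<^sub>R (1 / L) = p + (x - xb) /\<^sub>R (1 / L)"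
    "(xb - ?yb) /\<^sub>R (1 / L) = p"
    using L by (auto simp: algebra_simps)
  have "ereal (f x) \<le> ereal (f xb) + epi_scale (1 / L) \<phi> (x - ?yb) - epi_scale (1 / L) \<phi> (xb - ?yb)"
    using f unfolding aniso_smooth_def p_def Let_def by blast
  then have "f x \<le> f xb + 1 / L * \<phi>r (p + (x - xb) /\<^sub>R (1 / L)) - 1 / L * \<phi>r p"
    using mono(1) p epi_scale_ref_finite[of "1 / L" "x - ?yb"] epi_scale_ref_finite[of "1 / L" "xb - ?yb"]
    unfolding a by simp
  with mono(2) show ?thesis by linarith
qed

text \<open>
  The number \<open>D\<close> is \<open>\<gamma>\<close> times the gap. It also measures by how much \<open>x\<close> itself fails to
  minimize the model that defines the next iterate, which is the form needed for limit points.
\<close>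
lemma forward_backward_step:
  fixes x x' :: 'a
  assumes f: "aniso_smooth \<phi> L f" and c: "0 < \<gamma>" "\<gamma> \<le> 1 / L"
    and g: "proper g" and x: "x \<in> edom g"
  defines "p \<equiv> precond_grad \<phi> f x"
  assumes min: "is_arg_min (\<lambda>z. g z + epi_scale \<gamma> \<phi> (z - (x - \<gamma> *\<^sub>R p))) (\<lambda>_. True) x'"
  obtains D where "x' \<in> edom g"
    and "\<And>u. ereal (real_of_ereal (g x) + \<gamma> * \<phi>r p - D) \<le> g u + epi_scale \<gamma> \<phi> (u - (x - \<gamma> *\<^sub>R p))"
    and "0 \<le> D"
    and "f x' + real_of_ereal (g x') \<le> f x + real_of_ereal (g x) - D"
    and "gap \<phi> \<gamma> f g x = ereal (D / \<gamma>)"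
proof -
  let ?y = "x - \<gamma> *\<^sub>R p" and ?q = "p + (x' - x) /\<^sub>R \<gamma>"
  let ?m = "\<lambda>z. g z + epi_scale \<gamma> \<phi> (z - ?y)"
  have p: "p \<in> edom \<phi>" unfolding p_def precond_grad_def by (rule egrad_conjugate_minimizes(1))
  have le: "?m x' \<le> ?m u" for u
    using min by (auto simp: is_arg_min_def not_less)
  have ge: "g z > -\<infinity>" for z using g by (auto simp: proper_def)
  obtain gx where gx: "g x = ereal gx"
    using x ge[of x] by (cases "g x") (auto simp: edom_def)
  have mx: "?m x = ereal (gx + \<gamma> * \<phi>r p)"
    using gx p c epi_scale_ref_finite[of \<gamma> "x - ?y"] by simp
  have es: "epi_scale \<gamma> \<phi> (x' - ?y) = ereal \<gamma> * \<phi> ?q"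
    unfolding epi_scale_def using c by (simp add: algebra_simps)
  have lt: "?m x' < \<infinity>" using le[of x] mx by auto
  have q: "?q \<in> edom \<phi>"
  proof (rule ccontr)
    assume "?q \<notin> edom \<phi>"
    then have "?m x' = \<infinity>" using ge[of x'] c by (simp add: es ref_infinite)
    with lt show False by simp
  qed
  have es': "epi_scale \<gamma> \<phi> (x' - ?y) = ereal (\<gamma> * \<phi>r ?q)"
    unfolding es by (subst ref_finite[OF q]) simp
  obtain gx' where gx': "g x' = ereal gx'"
    using lt ge[of x'] es' by (cases "g x'") auto
  define D where "D = gx + \<gamma> * \<phi>r p - (gx' + \<gamma> * \<phi>r ?q)"
  have mx': "?m x' = ereal (gx + \<gamma> * \<phi>r p - D)" by (simp add: es' gx' D_def)
  have env: "aniso_envelope \<phi> \<gamma> g ?y = ereal (gx + \<gamma> * \<phi>r p - D)"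
    unfolding aniso_envelope_def mx'[symmetric]
    by (rule antisym) (auto intro: INF_lower INF_greatest le)
  show thesis
  proof (rule that[of D])
    show "x' \<in> edom g" using gx' by (simp add: edom_def)
    show "ereal (real_of_ereal (g x) + \<gamma> * \<phi>r p - D) \<le> ?m u" for u
      using le[of u] mx' gx by simp
    show "0 \<le> D" using le[of x] mx mx' by simp
    have "f x' \<le> f x + \<gamma> * \<phi>r ?q - \<gamma> * \<phi>r p"
      using aniso_descent[OF f c] q unfolding p_def by blast
    then show "f x' + real_of_ereal (g x') \<le> f x + real_of_ereal (g x) - D"
      using gx gx' by (simp add: D_def)
    have "gap \<phi> \<gamma> f g x = ereal (1 / \<gamma>) * (g x + ereal \<gamma> * \<phi> p - aniso_envelope \<phi> \<gamma> g ?y)"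
      unfolding gap_def p_def ..
    also have "\<dots> = ereal (1 / \<gamma>) * (ereal (gx + \<gamma> * \<phi>r p) - ereal (gx + \<gamma> * \<phi>r p - D))"
      unfolding env gx by (subst ref_finite[OF p]) simp
    finally show "gap \<phi> \<gamma> f g x = ereal (D / \<gamma>)" by simp
  qed
qed

text \<open>
  For fixed \<open>u\<close> near \<open>z\<close>, near-minimality of \<open>c j\<close> bounds \<open>g (c j)\<close> by the model value at \<open>u\<close>. The
  points where \<open>\<phi>\<close> is evaluated converge to \<open>p z + (u - z) / \<gamma>\<close>, an interior point of the domain, so
  the bound converges, and lower semicontinuity of \<open>g\<close> turns it into local minimality of \<open>z\<close>. The upper
  bound \<open>B\<close> on the objective ensures that \<open>g z\<close> is finite.
\<close>
lemma limit_point_stationary: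
  fixes c :: "nat \<Rightarrow> 'a"
  assumes f: "C1_on UNIV f" and g: "proper g" "lsc g" and \<gamma>: "0 < \<gamma>"
    and c: "c \<longlonglongrightarrow> z" and dom: "\<And>j. c j \<in> edom g"
    and bound: "\<And>j. f (c j) + real_of_ereal (g (c j)) \<le> B"
    and D: "D \<longlonglongrightarrow> 0"
  defines "p \<equiv> precond_grad \<phi> f"
  assumes le: "\<And>j u. ereal (real_of_ereal (g (c j)) + \<gamma> * \<phi>r (p (c j)) - D j)
      \<le> g u + epi_scale \<gamma> \<phi> (u - (c j - \<gamma> *\<^sub>R p (c j)))"
  shows "stationary_point (\<lambda>x. ereal (f x) + g x) z"
proof -
  have ge: "g u > -\<infinity>" for u using g by (auto simp: proper_def)
  have gc: "g (c j) = ereal (real_of_ereal (g (c j)))" for j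
    using ge[of "c j"] dom[of j] by (cases "g (c j)") (auto simp: edom_def)
  have Df: "GDERIV f z :> grad f z" by (rule C1_on_GDERIV[OF f]) simp
  have fc: "(\<lambda>j. f (c j)) \<longlonglongrightarrow> f z"
    using isCont_tendsto_compose[OF _ c] Df unfolding gderiv_def
    by (blast dest: has_derivative_continuous)
  have "isCont (grad f) z"
    using f unfolding C1_on_def by (simp add: continuous_on_eq_continuous_at)
  moreover have "isCont (egrad (conjugate \<phi>)) (grad f z)"
    using continuous_egrad_conjugate by (simp add: continuous_on_eq_continuous_at)
  ultimately have "isCont p z"
    unfolding p_def precond_grad_def by (rule isCont_o2)
  then have pc: "(\<lambda>j. p (c j)) \<longlonglongrightarrow> p z"
    using c by (rule isCont_tendsto_compose)
  have pz: "p z \<in> interior (edom \<phi>)"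
    unfolding p_def precond_grad_def by (rule egrad_conjugate_interior)
  have phi_pc: "(\<lambda>j. \<phi>r (p (c j))) \<longlonglongrightarrow> \<phi>r (p z)"
    by (rule isCont_tendsto_compose[OF ref_isCont_interior[OF pz] pc])
  have gz_le: "g z \<le> ereal (B - f z)"
  proof (rule lsc_le_limit[OF g(2) c])
    show "(\<lambda>j. B - f (c j)) \<longlonglongrightarrow> B - f z" by (intro tendsto_intros fc)
    have "g (c j) \<le> ereal (B - f (c j))" for j
      using bound[of j] by (subst gc) simp
    then show "\<forall>\<^sub>F j in sequentially. g (c j) \<le> ereal (B - f (c j))" by simp
  qed
  then obtain gz where gz: "g z = ereal gz" using ge[of z] by (cases "g z") auto
  define w where "w u = p z + (u - z) /\<^sub>R \<gamma>" for u
  have "isCont w z" unfolding w_def by (intro continuous_intros)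
  then have w: "(w \<longlongrightarrow> w z) (at z)" by (rule isContD)
  have wz: "w z = p z" by (simp add: w_def)
  have local_min: "g z + ereal (\<gamma> * \<phi>r (w z)) \<le> g u + ereal (\<gamma> * \<phi>r (w u))"
    if u: "w u \<in> interior (edom \<phi>)" for u
  proof (cases "g u")
    case (real gu)
    define W where "W j = p (c j) + (u - c j) /\<^sub>R \<gamma>" for j
    have W: "W \<longlonglongrightarrow> w u" unfolding W_def w_def by (intro tendsto_intros pc c)
    then have ev: "\<forall>\<^sub>F j in sequentially. W j \<in> interior (edom \<phi>)"
      using u by (blast intro: topological_tendstoD)
    have phiW: "(\<lambda>j. \<phi>r (W j)) \<longlonglongrightarrow> \<phi>r (w u)"
      by (rule isCont_tendsto_compose[OF ref_isCont_interior[OF u] W])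
    have "g z \<le> ereal (gu + \<gamma> * \<phi>r (w u) - \<gamma> * \<phi>r (p z) + 0)"
    proof (rule lsc_le_limit[OF g(2) c])
      show "(\<lambda>j. gu + \<gamma> * \<phi>r (W j) - \<gamma> * \<phi>r (p (c j)) + D j)
        \<longlonglongrightarrow> gu + \<gamma> * \<phi>r (w u) - \<gamma> * \<phi>r (p z) + 0"
        by (intro tendsto_intros phiW phi_pc D)
      show "\<forall>\<^sub>F j in sequentially. g (c j) \<le> ereal (gu + \<gamma> * \<phi>r (W j) - \<gamma> * \<phi>r (p (c j)) + D j)"
        using ev
      proof eventually_elim
        case (elim j)
        have eq: "(u - (c j - \<gamma> *\<^sub>R p (c j))) /\<^sub>R \<gamma> = W j"
          using \<gamma> by (simp add: W_def algebra_simps)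
        have "W j \<in> edom \<phi>" using elim interior_subset by blast
        then have "epi_scale \<gamma> \<phi> (u - (c j - \<gamma> *\<^sub>R p (c j))) = ereal (\<gamma> * \<phi>r (W j))"
          using epi_scale_ref_finite[of \<gamma> "u - (c j - \<gamma> *\<^sub>R p (c j))"] unfolding eq by blast
        then have "real_of_ereal (g (c j)) + \<gamma> * \<phi>r (p (c j)) - D j \<le> gu + \<gamma> * \<phi>r (W j)"
          using le[of j u] real by simp
        then show ?case by (subst gc) simp
      qed
    qed
    then show ?thesis using real gz by (simp add: wz)
  qed (use ge[of u] in auto)
  have Ds: "GDERIV (\<lambda>u. \<gamma> * \<phi>r (w u)) z :> grad f z"
  proof -
    have "(\<phi>r has_derivative (\<lambda>h. h \<bullet> grad f z)) (at (w z))"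
      using GDERIV_at_egrad_conjugate[of "grad f z"] unfolding wz
      by (simp add: gderiv_def p_def precond_grad_def)
    moreover have "(w has_derivative (\<lambda>h. h /\<^sub>R \<gamma>)) (at z)"
      unfolding w_def by (auto intro!: derivative_eq_intros)
    ultimately have "((\<lambda>u. \<phi>r (w u)) has_derivative (\<lambda>h. (h /\<^sub>R \<gamma>) \<bullet> grad f z)) (at z)"
      by (rule has_derivative_compose[rotated])
    then have "((\<lambda>u. \<gamma> * \<phi>r (w u)) has_derivative (\<lambda>h. \<gamma> * ((h /\<^sub>R \<gamma>) \<bullet> grad f z))) (at z)"
      by (rule has_derivative_mult_right)
    then show ?thesis using \<gamma> by (simp add: gderiv_def flip: mult.assoc)
  qed
  have "\<forall>\<^sub>F u in at z. g z + ereal (\<gamma> * \<phi>r (w z)) \<le> g u + ereal (\<gamma> * \<phi>r (w u))"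
  proof (rule eventually_mono)
    show "\<forall>\<^sub>F u in at z. w u \<in> interior (edom \<phi>)"
      using topological_tendstoD[OF w open_interior] pz wz by simp
  qed (rule local_min)
  then have "0 \<in> regular_subdiff (\<lambda>x. ereal (f x) + g x) z"
    by (rule regular_subgradient_zero_by_local_min[where g = g, OF Df Ds gz])
  then show ?thesis
    unfolding stationary_point_def using regular_subdiff_subset_limiting by blast
qed

end

section \<open>Convergence of the method\<close>

theorem theoremB0p7:
  fixes \<phi> g F :: "'a::euclidean_space \<Rightarrow> ereal"
    and f :: "'a \<Rightarrow> real"
    and x y :: "nat \<Rightarrow> 'a"
    and \<mu> L \<gamma> :: real
    and Fstar :: ereal
  assumes "reference_function \<mu> \<phi>"
    and "aniso_smooth \<phi> L f"
    and "proper g" and "lsc g"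
    and "prox_bounded g" and "prox_threshold g > ereal (\<gamma> / \<mu>)"
    and "0 < \<gamma>" and "\<gamma> \<le> 1 / L"
    and "F = (\<lambda>z. ereal (f z) + g z)"
    and "Fstar = (INF z. F z)" and "Fstar > - \<infinity>"
    and "x 0 \<in> edom g"
    and "\<forall>k. y k = x k - \<gamma> *\<^sub>R precond_grad \<phi> f (x k)"
    and "\<forall>k. is_arg_min (\<lambda>z. g z + epi_scale \<gamma> \<phi> (z - y k)) (\<lambda>_. True) (x (Suc k))"
  shows "(\<forall>k. F (x (Suc k)) \<le> F (x k) - ereal \<gamma> * gap \<phi> \<gamma> f g (x k))
    \<and> (\<forall>z. seq_limit_point x z \<longrightarrow> stationary_point F z)
    \<and> (\<forall>K\<ge>1. (MIN k\<in>{0..<K}. gap \<phi> \<gamma> f g (x k))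
               \<le> ereal (1 / (\<gamma> * real K)) * (F (x 0) - Fstar))"
proof -
  note ref = assms(1) and sm = assms(2) and g = assms(3) and c = assms(7,8) and F = assms(9)
  let ?gr = "\<lambda>k. real_of_ereal (g (x k))" and ?p = "\<lambda>k. precond_grad \<phi> f (x k)"
  let ?P = "\<lambda>k D. 0 \<le> D \<and> f (x (Suc k)) + ?gr (Suc k) \<le> f (x k) + ?gr k - D
      \<and> gap \<phi> \<gamma> f g (x k) = ereal (D / \<gamma>)
      \<and> (\<forall>u. ereal (?gr k + \<gamma> * real_of_ereal (\<phi> (?p k)) - D)
            \<le> g u + epi_scale \<gamma> \<phi> (u - (x k - \<gamma> *\<^sub>R ?p k)))"
  have min: "is_arg_min (\<lambda>z. g z + epi_scale \<gamma> \<phi> (z - (x k - \<gamma> *\<^sub>R ?p k))) (\<lambda>_. True) (x (Suc k))" for k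
    using assms(13,14) by metis
  have dom: "x k \<in> edom g" for k
  proof (induction k)
    case (Suc k)
    show ?case by (rule forward_backward_step[OF ref sm c g Suc.IH min])
  qed (rule assms(12))
  have "\<exists>D. ?P k D" for k
    by (rule forward_backward_step[OF ref sm c g dom min]) blast
  then obtain D where D: "\<And>k. ?P k (D k)" by metis
  define a where "a k = f (x k) + ?gr k" for k
  have Fa: "F (x k) = ereal (a k)" for k
    using g dom[of k] unfolding F a_def proper_def edom_def by (cases "g (x k)") auto
  have dec: "a (Suc k) \<le> a k - D k" and D0: "0 \<le> D k" for k using D[of k] by (auto simp: a_def)
  have gapD: "gap \<phi> \<gamma> f g (x k) = ereal (D k / \<gamma>)" for k using D by blast
  have "Fstar \<le> ereal (a k)" for k using assms(10) Fa by (metis INF_lower UNIV_I)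
  then obtain m where m: "Fstar = ereal m" using assms(11) by (cases Fstar) auto
  have ma: "m \<le> a k" for k using \<open>\<And>k. Fstar \<le> ereal (a k)\<close>[of k] m by simp
  have tele: "(\<Sum>k<K. D k) \<le> a 0 - a K" for K
  proof (induction K)
    case (Suc K)
    then show ?case using dec[of K] by simp
  qed simp
  have part1: "F (x (Suc k)) \<le> F (x k) - ereal \<gamma> * gap \<phi> \<gamma> f g (x k)" for k
    using dec[of k] c by (simp add: Fa gapD)
  have part3: "(MIN k\<in>{0..<K}. gap \<phi> \<gamma> f g (x k)) \<le> ereal (1 / (\<gamma> * real K)) * (F (x 0) - Fstar)"
    if K: "K \<ge> 1" for K
  proof (rule ccontr)
    let ?b = "(a 0 - m) / (\<gamma> * real K)"
    assume "\<not> ?thesis"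
    then have lt: "ereal ?b < (MIN k\<in>{0..<K}. gap \<phi> \<gamma> f g (x k))"
      by (simp add: Fa m)
    have "(a 0 - m) / real K < D k" if k: "k < K" for k
    proof -
      have "(MIN k\<in>{0..<K}. gap \<phi> \<gamma> f g (x k)) \<le> gap \<phi> \<gamma> f g (x k)"
        using k by (intro Min_le) auto
      with lt have "ereal ?b < ereal (D k / \<gamma>)" unfolding gapD[of k] by order
      moreover have "?b = (a 0 - m) / real K / \<gamma>" by simp
      ultimately have "(a 0 - m) / real K / \<gamma> < D k / \<gamma>" by (simp only: less_ereal.simps)
      then show ?thesis using c(1) by (simp only: divide_less_cancel)
    qed
    then have "(\<Sum>k<K. (a 0 - m) / real K) < (\<Sum>k<K. D k)"
      using K by (intro sum_strict_mono) (auto simp: lessThan_empty_iff)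
    then show False using tele[of K] ma[of K] K by simp
  qed
  have "summable D"
  proof (rule summableI_nonneg_bounded[OF D0])
    show "(\<Sum>k<K. D k) \<le> a 0 - m" for K using tele[of K] ma[of K] by simp
  qed
  then have Dlim: "D \<longlonglongrightarrow> 0" by (rule summable_LIMSEQ_zero)
  have anti: "a k \<le> a 0" for k
  proof (induction k)
    case (Suc k)
    then show ?case using dec[of k] D0[of k] by simp
  qed simp
  have part2: "stationary_point F z" if z: "seq_limit_point x z" for z
  proof -
    obtain r where r: "strict_mono r" "(x \<circ> r) \<longlonglongrightarrow> z"
      using z unfolding seq_limit_point_def by blast
    show ?thesis unfolding F
    proof (rule limit_point_stationary[OF ref _ g assms(4) c(1) r(2)])
      show "C1_on UNIV f" using sm unfolding aniso_smooth_def by blast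
      show "(D \<circ> r) \<longlonglongrightarrow> 0" by (rule LIMSEQ_subseq_LIMSEQ[OF Dlim r(1)])
      show "f ((x \<circ> r) j) + real_of_ereal (g ((x \<circ> r) j)) \<le> a 0" for j
        using anti[of "r j"] by (simp add: a_def)
    qed (use D dom in auto)
  qed
  from part1 part2 part3 show ?thesis by blast
qed

end
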